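(* Let $\alpha,\beta_0,\beta_1,d$ be positive integers, let $r$ be a nonnegative integer, and let $p_m$ and $q_m$ be the numerators and denominators of the convergents $p_m/q_m$ of the continued fraction $\xi(\alpha,\beta_0,\beta_1,d,r)$. Let $$\sigma=\frac{\beta_0-\alpha}{\beta_1}+\frac{L_d(\alpha)}{\beta_1F_d(\alpha)},\qquad \rho=\frac{(-1)^{d-1}}{\beta_1^2F_d(\alpha)^2}.$$ Then $$\lim_{n\to\infty}\frac{p_{nd+r-1}}{F_d(\alpha)^n\beta_1^n(\sigma+n-1)_n}=F_{r+1}(\alpha)\sum_{m=0}^\infty\frac{\rho^m}{m!(\sigma+m-1)_m}+(-1)^{d-r}F_{d-r-1}(\alpha)F_d(\alpha)\beta_1\sum_{m=0}^\infty\frac{\rho^{m+1}}{m!(\sigma+m)_{m+1}}$$ and $$\lim_{n\to\infty}\frac{q_{nd+r-1}}{F_d(\alpha)^n\beta_1^n(\sigma+n-1)_n}=F_{r}(\alpha)\sum_{m=0}^\infty\frac{\rho^m}{m!(\sigma+m-1)_m}+(-1)^{d-r+1}F_{d-r}(\alpha)F_d(\alpha)\beta_1\sum_{m=0}^\infty\frac{\rho^{m+1}}{m!(\sigma+m)_{m+1}}.$$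
   Context: Continued fraction: $\xi(\alpha,\beta_0,\beta_1,d,r)=[a_0,a_1,a_2,\ldots]$ is the infinite simple continued fraction $[\underbrace{\alpha,\ldots,\alpha}_r,\beta_0,\overline{\underbrace{\alpha,\ldots,\alpha,\beta_0+\beta_1 n}_d}]_{n=1}^\infty$; that is, $a_{r+jd}=\beta_0+\beta_1 j$ for all integers $j\ge 0$, and $a_i=\alpha$ for every other index $i\ge 0$. Convergents: $p_m,q_m$ are defined by $p_{-1}=1$, $p_0=a_0$, $q_{-1}=0$, $q_0=1$ and $p_m=a_mp_{m-1}+p_{m-2}$, $q_m=a_mq_{m-1}+q_{m-2}$ for $m\ge1$. Fibonacci and Lucas polynomials: $F_0(q)=0$, $F_1(q)=1$, $L_0(q)=2$, $L_1(q)=q$, and $X_n(q)=qX_{n-1}(q)+X_{n-2}(q)$ for $X\in\{F,L\}$. The sequence $F_n$ is extended to negative indices by the same recurrence (equivalently $F_{-n}(q)=(-1)^{n+1}F_n(q)$). Falling factorial: $(x)_j=x(x-1)\cdots(x-j+1)$ for an integer $j\ge 0$, with $(x)_0=1$. *)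

theory Defs
  imports
    "HOL-Computational_Algebra.Polynomial"
    "HOL-Analysis.Analysis"
begin

fun fib_poly_nat :: "nat \<Rightarrow> 'a::comm_ring_1 poly" where
  "fib_poly_nat 0 = 0"
| "fib_poly_nat (Suc 0) = 1"
| "fib_poly_nat (Suc (Suc n)) = [:0, 1:] * fib_poly_nat (Suc n) + fib_poly_nat n"

definition fib_poly :: "int \<Rightarrow> 'a::comm_ring_1 poly" where
  "fib_poly n = (if n \<ge> 0 then fib_poly_nat (nat n)
                 else (- 1) ^ (nat (- n) + 1) * fib_poly_nat (nat (- n)))"

fun lucas_poly :: "nat \<Rightarrow> 'a::comm_ring_1 poly" where
  "lucas_poly 0 = [:2:]"
| "lucas_poly (Suc 0) = [:0, 1:]"
| "lucas_poly (Suc (Suc n)) = [:0, 1:] * lucas_poly (Suc n) + lucas_poly n"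

lemma fib_poly_rec: "fib_poly n = [:0, 1:] * fib_poly (n - 1) + fib_poly (n - 2)"
proof -
  consider "n \<ge> 2" | "n = 1" | "n \<le> 0" by linarith
  then show ?thesis
  proof cases
    case 1
    define k where "k = nat (n - 2)"
    have "n = int k + 2" using 1 by (simp add: k_def)
    then have "nat n = Suc (Suc k)" "nat (n - 1) = Suc k" "nat (n - 2) = k" by linarith+
    then show ?thesis using 1 by (simp add: fib_poly_def)
  next
    case 2
    then show ?thesis by (simp add: fib_poly_def)
  next
    case 3
    define k where "k = nat (- n)"
    have n: "n = - int k" using 3 by (simp add: k_def)
    have "nat (- (n - 1)) = Suc k" "nat (- (n - 2)) = Suc (Suc k)" using n by linarith+
    then show ?thesis using n
      by (cases "k = 0") (simp_all add: fib_poly_def algebra_simps numeral_2_eq_2)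
  qed
qed

text \<open>Partial quotients \<open>a\<^sub>i\<close> of the continued fraction \<open>\<xi>(\<alpha>, \<beta>\<^sub>0, \<beta>\<^sub>1, d, r)\<close>.\<close>

definition xi_quot :: "int \<Rightarrow> int \<Rightarrow> int \<Rightarrow> nat \<Rightarrow> nat \<Rightarrow> nat \<Rightarrow> int" where
  "xi_quot \<alpha> \<beta>\<^sub>0 \<beta>\<^sub>1 d r i =
     (if r \<le> i \<and> d dvd (i - r) then \<beta>\<^sub>0 + \<beta>\<^sub>1 * int ((i - r) div d) else \<alpha>)"

lemma xi_quot_special: "d > 0 \<Longrightarrow> xi_quot \<alpha> \<beta>\<^sub>0 \<beta>\<^sub>1 d r (r + j * d) = \<beta>\<^sub>0 + \<beta>\<^sub>1 * int j"
  by (simp add: xi_quot_def)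

lemma xi_quot_other: "(\<And>j. i \<noteq> r + j * d) \<Longrightarrow> xi_quot \<alpha> \<beta>\<^sub>0 \<beta>\<^sub>1 d r i = \<alpha>"
  unfolding xi_quot_def by (metis dvd_div_mult_self le_add_diff_inverse)

text \<open>The auxiliary functions are shifted by one: argument \<open>k\<close> gives the convergent of index
  \<open>k - 1\<close>, so that the recurrence can start at index \<open>-1\<close>.\<close>

fun conv_num_shift :: "(nat \<Rightarrow> int) \<Rightarrow> nat \<Rightarrow> int" where
  "conv_num_shift a 0 = 1"
| "conv_num_shift a (Suc 0) = a 0"
| "conv_num_shift a (Suc (Suc k)) = a (Suc k) * conv_num_shift a (Suc k) + conv_num_shift a k"

fun conv_denom_shift :: "(nat \<Rightarrow> int) \<Rightarrow> nat \<Rightarrow> int" where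
  "conv_denom_shift a 0 = 0"
| "conv_denom_shift a (Suc 0) = 1"
| "conv_denom_shift a (Suc (Suc k)) = a (Suc k) * conv_denom_shift a (Suc k) + conv_denom_shift a k"

text \<open>Numerator and denominator of the \<open>m\<close>-th convergent; only \<open>m \<ge> -1\<close> is meaningful.\<close>

definition conv_num :: "(nat \<Rightarrow> int) \<Rightarrow> int \<Rightarrow> int" where
  "conv_num a m = conv_num_shift a (nat (m + 1))"

definition conv_denom :: "(nat \<Rightarrow> int) \<Rightarrow> int \<Rightarrow> int" where
  "conv_denom a m = conv_denom_shift a (nat (m + 1))"

lemma conv_num_simps:
  "conv_num a (- 1) = 1"
  "conv_num a 0 = a 0"
  "m \<ge> 1 \<Longrightarrow> conv_num a m = a (nat m) * conv_num a (m - 1) + conv_num a (m - 2)"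
proof -
  assume "m \<ge> 1"
  then obtain k where "m = int (Suc k)" by (metis zero_less_imp_eq_int gr0_implies_Suc zero_less_one order_less_le_trans)
  then have "nat (m + 1) = Suc (Suc k)" "nat (m - 1 + 1) = Suc k" "nat (m - 2 + 1) = k"
    "nat m = Suc k" by linarith+
  then show "conv_num a m = a (nat m) * conv_num a (m - 1) + conv_num a (m - 2)"
    by (simp add: conv_num_def)
qed (simp_all add: conv_num_def)

lemma conv_denom_simps:
  "conv_denom a (- 1) = 0"
  "conv_denom a 0 = 1"
  "m \<ge> 1 \<Longrightarrow> conv_denom a m = a (nat m) * conv_denom a (m - 1) + conv_denom a (m - 2)"
proof -
  assume "m \<ge> 1"
  then obtain k where "m = int (Suc k)" by (metis zero_less_imp_eq_int gr0_implies_Suc zero_less_one order_less_le_trans)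
  then have "nat (m + 1) = Suc (Suc k)" "nat (m - 1 + 1) = Suc k" "nat (m - 2 + 1) = k"
    "nat m = Suc k" by linarith+
  then show "conv_denom a m = a (nat m) * conv_denom a (m - 1) + conv_denom a (m - 2)"
    by (simp add: conv_denom_def)
qed (simp_all add: conv_denom_def)

definition falling_fact :: "'a::comm_ring_1 \<Rightarrow> nat \<Rightarrow> 'a" where
  "falling_fact x j = (\<Prod>i<j. x - of_nat i)"

end

theory Submission
  imports Defs
begin

text \<open>Between two special partial quotients the recurrence of the convergents has the constant
  coefficient \<open>\<alpha>\<close>, so a block of length \<open>d\<close> is a Fibonacci matrix. Eliminating one component and
  normalising gives \<open>u\<^sub>n\<^sub>+\<^sub>2 = u\<^sub>n\<^sub>+\<^sub>1 + \<rho> / ((\<sigma> + n)(\<sigma> + n + 1)) u\<^sub>n\<close>. The function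
  \<open>f(b) = \<^sub>0F\<^sub>1(; b; \<rho>)\<close> satisfies the adjoint recurrence
  \<open>f(b) = f(b + 1) + \<rho> / (b(b + 1)) f(b + 2)\<close>, hence
  \<open>u\<^sub>n\<^sub>+\<^sub>1 f(\<sigma> + n + 1) + \<rho> / ((\<sigma> + n)(\<sigma> + n + 1)) u\<^sub>n f(\<sigma> + n + 2)\<close> does not depend on \<open>n\<close>.
  As \<open>u\<close> is bounded and \<open>f(\<sigma> + n) \<longlonglongrightarrow> 1\<close>, the limit of \<open>u\<close> is the value of this invariant
  at \<open>n = 0\<close>.\<close>

section \<open>The confluent hypergeometric limit function\<close>

definition hyp0F1 :: "real \<Rightarrow> real \<Rightarrow> real" where
  "hyp0F1 b z = (\<Sum>m. z ^ m / (fact m * pochhammer b m))"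

text \<open>Reading the falling product from its last factor upwards gives the rising factorial;
  this turns the series of the theorem into values of \<open>hyp0F1\<close>.\<close>

lemma falling_fact_eq_pochhammer: "falling_fact (x + of_nat n - 1) n = pochhammer x n"
proof -
  have "falling_fact (x + of_nat n - 1) n = (\<Prod>i<n. x + of_nat (n - Suc i))"
    unfolding falling_fact_def by (intro prod.cong) (auto simp: of_nat_diff)
  also have "\<dots> = pochhammer x n"
    unfolding pochhammer_prod atLeast0LessThan by (rule prod.nat_diff_reindex)
  finally show ?thesis .
qed

lemma pochhammer_ge_power:
  assumes "b > (0::real)" shows "b ^ m \<le> pochhammer b m"
proof (induction m)
  case (Suc m)
  then have "b ^ m * b \<le> pochhammer b m * (b + real m)"
    using assms by (intro mult_mono) (auto simp: pochhammer_nonneg)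
  then show ?case by (simp add: pochhammer_Suc mult.commute)
qed simp

text \<open>Every factor b + i of the rising factorial is at least b, so the exponential series at
  \<bar>z\<bar> / b dominates termwise. This gives both convergence and, since both series start
  with 1, the distance of \<open>hyp0F1\<close> from 1.\<close>

lemma hyp0F1_term_bound:
  fixes b z :: real
  assumes "b > 0"
  shows "\<bar>z ^ m / (fact m * pochhammer b m)\<bar> \<le> (\<bar>z\<bar> / b) ^ m /\<^sub>R fact m"
proof -
  have "\<bar>z ^ m / (fact m * pochhammer b m)\<bar> = \<bar>z\<bar> ^ m / (fact m * pochhammer b m)"
    using pochhammer_pos[OF assms, of m] by (simp add: abs_mult power_abs)
  also have "\<dots> \<le> \<bar>z\<bar> ^ m / (fact m * b ^ m)"
    using pochhammer_ge_power[OF assms] assms by (intro divide_left_mono mult_left_mono) (auto simp: pochhammer_pos)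
  finally show ?thesis
    by (simp add: power_divide field_simps)
qed

lemma hyp0F1_summable:
  fixes b z :: real
  assumes "b > 0" shows "summable (\<lambda>m. z ^ m / (fact m * pochhammer b m))"
  by (rule summable_comparison_test'[OF summable_exp_generic[of "\<bar>z\<bar> / b"], of 0])
    (use hyp0F1_term_bound[OF assms] in auto)

lemma hyp0F1_near_1:
  assumes "b > 0" shows "\<bar>hyp0F1 b z - 1\<bar> \<le> exp (\<bar>z\<bar> / b) - 1"
proof -
  define t where "t = (\<lambda>m. z ^ m / (fact m * pochhammer b m))"
  define e where "e = (\<lambda>m. (\<bar>z\<bar> / b) ^ m /\<^sub>R fact m)"
  have t: "summable t" and e: "summable e"
    unfolding t_def e_def by (rule hyp0F1_summable[OF assms], rule summable_exp_generic)
  have le: "norm (t (Suc m)) \<le> e (Suc m)" for m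
    using hyp0F1_term_bound[OF assms] by (simp add: t_def e_def del: fact_Suc power_Suc)
  have "hyp0F1 b z - 1 = (\<Sum>m. t (Suc m))"
    using suminf_split_head[OF t] by (simp add: hyp0F1_def t_def)
  moreover have "exp (\<bar>z\<bar> / b) - 1 = (\<Sum>m. e (Suc m))"
    using suminf_split_head[OF e] by (simp add: exp_def e_def)
  moreover have "norm (\<Sum>m. t (Suc m)) \<le> (\<Sum>m. e (Suc m))"
    using le e by (intro norm_suminf_le) (auto simp: summable_Suc_iff)
  ultimately show ?thesis by simp
qed

lemma hyp0F1_tendsto_1: "((\<lambda>b. hyp0F1 b z) \<longlongrightarrow> 1) at_top"
proof -
  have "((\<lambda>b. exp (\<bar>z\<bar> / b) - 1) \<longlongrightarrow> exp 0 - 1) at_top"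
    by (intro tendsto_intros tendsto_divide_0[OF tendsto_const] filterlim_at_top_imp_at_infinity
        filterlim_ident)
  then have exp: "((\<lambda>b. exp (\<bar>z\<bar> / b) - 1) \<longlongrightarrow> 0) at_top"
    by simp
  have "\<forall>\<^sub>F b in at_top. norm (hyp0F1 b z - 1) \<le> exp (\<bar>z\<bar> / b) - 1"
    using eventually_gt_at_top[of 0] by eventually_elim (simp add: hyp0F1_near_1)
  then have "((\<lambda>b. hyp0F1 b z - 1) \<longlongrightarrow> 0) at_top"
    using exp by (rule Lim_null_comparison)
  then show ?thesis by (rule LIM_zero_cancel)
qed

lemma hyp0F1_contiguous:
  assumes "b > 0"
  shows "hyp0F1 b z = hyp0F1 (b + 1) z + z / (b * (b + 1)) * hyp0F1 (b + 2) z"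
proof -
  define t where "t = (\<lambda>b m. z ^ m / (fact m * pochhammer b m))"
  have s: "summable (t b)" "summable (t (b + 1))" "summable (t (b + 2))"
    unfolding t_def using assms by (auto intro!: hyp0F1_summable)
  \<comment> \<open>With P the rising factorial of b + 2, the reciprocals of the two rising
    factorials differ by (m + 1) / (b (b + 1) P); the factor m + 1 reduces (m + 1)! to m!. The terms
    at index 0 are both 1 and cancel.\<close>
  have step: "t b (Suc m) - t (b + 1) (Suc m) = z / (b * (b + 1)) * t (b + 2) m" for m
  proof -
    define P where "P = pochhammer (b + 2) m"
    have P: "P > 0" using assms by (simp add: P_def pochhammer_pos)
    have b1: "pochhammer (b + 1) (Suc m) = (b + 1) * P"
      by (simp add: pochhammer_rec P_def add.assoc)
    have "pochhammer b (Suc (Suc m)) = b * ((b + 1) * P)"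
      by (subst pochhammer_rec) (simp add: b1)
    then have b0: "pochhammer b (Suc m) = b * ((b + 1) * P) / (b + 1 + m)"
      using assms by (subst (asm) pochhammer_Suc) (simp add: field_simps)
    show ?thesis
      unfolding t_def b0 b1 P_def[symmetric] using assms P
      by (simp add: divide_simps) (simp add: algebra_simps)
  qed
  have "hyp0F1 b z - hyp0F1 (b + 1) z = (\<Sum>m. t b (Suc m) - t (b + 1) (Suc m))"
    using suminf_split_head[OF s(1)] suminf_split_head[OF s(2)] s
    by (subst suminf_diff[symmetric]) (simp_all add: summable_Suc_iff, simp add: hyp0F1_def t_def)
  also have "\<dots> = z / (b * (b + 1)) * hyp0F1 (b + 2) z"
    unfolding step suminf_mult[OF s(3)] by (simp add: hyp0F1_def t_def)
  finally show ?thesis by simp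
qed

section \<open>Limits of three-term recurrences\<close>

text \<open>One step enlarges a common bound of two consecutive terms by at most the factor 1 + h,
  where h = \<bar>\<rho>\<bar> / ((\<sigma> + n)(\<sigma> + n + 1)) is summable over n, so the
  product of these factors stays bounded.\<close>

lemma three_term_bounded:
  fixes u :: "nat \<Rightarrow> real"
  assumes \<sigma>: "\<sigma> > 0"
    and rec: "\<And>n. u (Suc (Suc n)) = u (Suc n) + \<rho> / ((\<sigma> + n) * (\<sigma> + n + 1)) * u n"
  shows "Bseq u"
proof -
  define C where "C = max \<bar>u 0\<bar> \<bar>u 1\<bar>"
  \<comment> \<open>The exponent is the closed form of the sum of h over the indices below n, so E
    grows by exactly exp h in each step and never exceeds C * exp (\<bar>\<rho>\<bar> /
    \<sigma>).\<close>
  define E where "E = (\<lambda>n::nat. C * exp (\<bar>\<rho>\<bar> / \<sigma> - \<bar>\<rho>\<bar> / (\<sigma> + n)))"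
  have E_Suc: "E n * (1 + \<bar>\<rho>\<bar> / ((\<sigma> + n) * (\<sigma> + n + 1))) \<le> E (Suc n)" for n
  proof -
    define h where "h = \<bar>\<rho>\<bar> / ((\<sigma> + n) * (\<sigma> + n + 1))"
    \<comment> \<open>\<open>1 + h \<le> exp h\<close>, and the sum of the \<open>h\<close> telescopes\<close>
    have h: "h = \<bar>\<rho>\<bar> / (\<sigma> + n) - \<bar>\<rho>\<bar> / (\<sigma> + Suc n)"
      using \<sigma> by (simp add: h_def field_simps)
    have "E n * (1 + h) \<le> E n * exp h"
      by (intro mult_left_mono) (auto simp: E_def C_def le_max_iff_disj)
    also have "\<dots> = E (Suc n)"
      unfolding E_def h by (simp flip: exp_add)
    finally show ?thesis by (simp add: h_def)
  qed
  have "\<bar>u n\<bar> \<le> E n \<and> \<bar>u (Suc n)\<bar> \<le> E n" for n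
  proof (induction n)
    case 0
    show ?case by (auto simp: E_def C_def)
  next
    case (Suc n)
    define h where "h = \<bar>\<rho>\<bar> / ((\<sigma> + n) * (\<sigma> + n + 1))"
    have h: "h \<ge> 0" "\<bar>\<rho> / ((\<sigma> + n) * (\<sigma> + n + 1))\<bar> = h"
      using \<sigma> by (auto simp: h_def abs_mult)
    have E0: "E n \<ge> 0" by (auto simp: E_def C_def le_max_iff_disj)
    have "\<bar>u (Suc (Suc n))\<bar> \<le> \<bar>u (Suc n)\<bar> + h * \<bar>u n\<bar>"
      unfolding rec h(2)[symmetric] abs_mult[symmetric] by (rule abs_triangle_ineq)
    also have "\<dots> \<le> E n + h * E n"
      using Suc h by (intro add_mono mult_left_mono) auto
    also have "\<dots> \<le> E (Suc n)" using E_Suc[of n] by (simp add: h_def algebra_simps)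
    finally have "\<bar>u (Suc (Suc n))\<bar> \<le> E (Suc n)" .
    moreover have "E n * 1 \<le> E n * (1 + h)"
      using E0 h by (intro mult_left_mono) auto
    ultimately show ?case using Suc E_Suc[of n] by (simp add: h_def)
  qed
  moreover have "E n \<le> C * exp (\<bar>\<rho>\<bar> / \<sigma>)" for n
    unfolding E_def using \<sigma> by (intro mult_left_mono) (auto simp: C_def le_max_iff_disj)
  ultimately have "norm (u n) \<le> C * exp (\<bar>\<rho>\<bar> / \<sigma>)" for n
    unfolding real_norm_def by (metis order_trans)
  then show ?thesis by (rule BseqI')
qed

lemma three_term_limit:
  fixes u :: "nat \<Rightarrow> real"
  assumes \<sigma>: "\<sigma> > 0"
    and rec: "\<And>n. u (Suc (Suc n)) = u (Suc n) + \<rho> / ((\<sigma> + n) * (\<sigma> + n + 1)) * u n"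
  shows "u \<longlonglongrightarrow> u 0 * hyp0F1 \<sigma> \<rho> + (u 1 - u 0) * hyp0F1 (\<sigma> + 1) \<rho>" (is "_ \<longlonglongrightarrow> ?l")
proof -
  define f where "f = (\<lambda>n::nat. hyp0F1 (\<sigma> + n) \<rho>)"
  define h where "h = (\<lambda>n::nat. \<rho> / ((\<sigma> + n) * (\<sigma> + n + 1)))"
  have f_rec: "f n = f (Suc n) + h n * f (Suc (Suc n))" for n
    using hyp0F1_contiguous[of "\<sigma> + n" \<rho>] \<sigma> by (simp add: f_def h_def add_ac)
  \<comment> \<open>At n = 0, \<open>f_rec\<close> replaces h 0 * f 2 by f 0 - f 1, which leaves
    only the parameters \<sigma> and \<sigma> + 1 of the two series in the theorem.\<close>
  have invar: "u (Suc n) * f (Suc n) + h n * u n * f (Suc (Suc n)) = ?l" for n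
  proof (induction n)
    case 0
    show ?case using f_rec[of 0] by (simp add: f_def algebra_simps)
  next
    case (Suc n)
    have "u (Suc (Suc n)) = u (Suc n) + h n * u n"
      using rec[of n] by (simp add: h_def)
    then show ?case using Suc f_rec[of "Suc n"] by (simp add: algebra_simps)
  qed
  have top: "filterlim (\<lambda>n::nat. \<sigma> + n) at_top sequentially"
    by (intro filterlim_tendsto_add_at_top[OF tendsto_const] filterlim_real_sequentially)
  have f1: "f \<longlonglongrightarrow> 1"
    unfolding f_def by (rule filterlim_compose[OF hyp0F1_tendsto_1 top])
  have "filterlim (\<lambda>n. (\<sigma> + real n) * (\<sigma> + real n + 1)) at_top sequentially"
    using filterlim_tendsto_add_at_top[OF tendsto_const[of 1] top]
    by (intro filterlim_at_top_mult_at_top top) (simp add: add_ac)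
  then have h0: "h \<longlonglongrightarrow> 0"
    unfolding h_def by (intro tendsto_divide_0[OF tendsto_const] filterlim_at_top_imp_at_infinity)
  have "Zfun (\<lambda>n. h n * u n) sequentially"
    using h0 three_term_bounded[OF \<sigma> rec]
    by (intro bounded_bilinear.Zfun_prod_Bfun[OF bounded_bilinear_mult]) (auto simp: tendsto_Zfun_iff)
  then have hu: "(\<lambda>n. h n * u n) \<longlonglongrightarrow> 0" by (simp add: tendsto_Zfun_iff)
  have "(\<lambda>n. (?l - h n * u n * f (Suc (Suc n))) / f (Suc n)) \<longlonglongrightarrow> (?l - 0 * 1) / 1"
    using f1 by (intro tendsto_intros hu) (auto intro: LIMSEQ_Suc)
  \<comment> \<open>The invariant is solved for u (Suc n). For negative \<rho> the function f may
    vanish at small n, so the division is justified only eventually.\<close>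
  moreover have "eventually (\<lambda>n. f (Suc n) > 0) sequentially"
    using LIMSEQ_Suc[OF f1] by (rule order_tendstoD) simp
  then have "eventually (\<lambda>n. (?l - h n * u n * f (Suc (Suc n))) / f (Suc n) = u (Suc n)) sequentially"
  proof eventually_elim
    case (elim n)
    then show ?case using invar[of n] by (simp add: field_simps)
  qed
  ultimately have "(\<lambda>n. u (Suc n)) \<longlonglongrightarrow> ?l"
    by (simp add: tendsto_cong)
  then show ?thesis by (rule LIMSEQ_imp_Suc)
qed

section \<open>Fibonacci and Lucas polynomials\<close>

lemma fib_poly_0 [simp]: "fib_poly 0 = 0" and fib_poly_1 [simp]: "fib_poly 1 = 1"
  and fib_poly_minus_1 [simp]: "fib_poly (- 1) = 1"
  by (simp_all add: fib_poly_def)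

lemma poly_fib_rec:
  "poly (fib_poly n) x = x * poly (fib_poly (n - 1)) x + poly (fib_poly (n - 2)) x"
  by (subst fib_poly_rec) simp

text \<open>The left side is a 2 by 2 determinant that changes sign when n and r are both lowered by
  one; at r = 0 it is F_n because F_{-1} = 1. It yields both the determinant of a block and the
  initial data, where n - r may be negative.\<close>

lemma fib_poly_dOcagne:
  "poly (fib_poly n) x * poly (fib_poly (int r - 1)) x
     - poly (fib_poly (n - 1)) x * poly (fib_poly (int r)) x
   = (- 1) ^ r * poly (fib_poly (n - int r)) x"
proof (induction r arbitrary: n)
  case 0
  show ?case by simp
next
  case (Suc r)
  define f where "f n = poly (fib_poly n) x" for n
  have f_n: "f n = x * f (n - 1) + f (n - 2)" and f_r: "f (int r + 1) = x * f (int r) + f (int r - 1)"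
    unfolding f_def by (subst poly_fib_rec, simp)+
  have "f n * f (int r) - f (n - 1) * f (int r + 1)
      = - (f (n - 1) * f (int r - 1) - f (n - 1 - 1) * f (int r))"
    unfolding f_n f_r by (simp add: algebra_simps)
  also have "\<dots> = (- 1) ^ Suc r * f (n - int (Suc r))"
    unfolding Suc[of "n - 1", folded f_def] by (simp add: algebra_simps)
  finally show ?case by (simp add: f_def add.commute)
qed

lemma fib_poly_nonneg:
  assumes "x > (0::real)"
  shows "poly (fib_poly (int n)) x \<ge> 0 \<and> poly (fib_poly (int (Suc n))) x > 0"
proof (induction n)
  case (Suc n)
  then show ?case
    using assms poly_fib_rec[of "int (Suc (Suc n))" x] by (simp add: add_pos_nonneg)
qed simp

text \<open>Serves to remove L_d from \<sigma>: the summand x F_d cancels the -\<alpha>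
  there.\<close>

lemma lucas_poly_eq_fib_poly:
  "poly (lucas_poly n) x = x * poly (fib_poly (int n)) x + 2 * poly (fib_poly (int n - 1)) x"
proof (induction n rule: lucas_poly.induct)
  case (3 n)
  then show ?case
    using poly_fib_rec[of "int n + 2" x] poly_fib_rec[of "int n + 1" x]
    by (simp add: algebra_simps)
qed simp_all

section \<open>Convergents along the special partial quotients\<close>

text \<open>In the shifted indexing, \<open>x (r + n d)\<close> is the convergent number \<open>n d + r - 1\<close>.\<close>

lemma xi_initial_segment:
  fixes \<alpha> \<beta>\<^sub>0 \<beta>\<^sub>1 :: int and d r :: nat and x :: "nat \<Rightarrow> real"
  defines "F \<equiv> \<lambda>n. poly (fib_poly n) (of_int \<alpha> :: real)"
  assumes rec: "\<And>k. x (Suc (Suc k)) = of_int (xi_quot \<alpha> \<beta>\<^sub>0 \<beta>\<^sub>1 d r (Suc k)) * x (Suc k) + x k"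
    and x0: "x 0 = F e" and x1: "x 1 = of_int (xi_quot \<alpha> \<beta>\<^sub>0 \<beta>\<^sub>1 d r 0) * F e + F (e - 1)"
  shows "x r = F (int r + e)" and "x (Suc r) = of_int \<beta>\<^sub>0 * F (int r + e) + F (int r + e - 1)"
proof -
  define a where "a = xi_quot \<alpha> \<beta>\<^sub>0 \<beta>\<^sub>1 d r"
  have a: "k < r \<Longrightarrow> a k = \<alpha>" "a r = \<beta>\<^sub>0" for k
    by (simp_all add: xi_quot_def a_def)
  \<comment> \<open>Keeping a k unevaluated lets one statement cover k < r, where it is \<alpha>,
    and k = r, where it is \<open>\<beta>\<^sub>0\<close>; this includes r = 0.\<close>
  have "k \<le> r \<Longrightarrow> x k = F (int k + e) \<and> x (Suc k) = of_int (a k) * F (int k + e) + F (int k + e - 1)" for k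
  proof (induction k)
    case 0
    show ?case using x0 x1 by (simp add: a_def)
  next
    case (Suc k)
    then have "x (Suc k) = F (int (Suc k) + e)"
      using a(1)[of k] poly_fib_rec[of "int (Suc k) + e" "of_int \<alpha> :: real"]
      by (simp add: F_def algebra_simps)
    then show ?case
      using Suc rec[of k] by (simp add: a_def add_ac)
  qed
  from this[of r] a(2) show "x r = F (int r + e)"
    "x (Suc r) = of_int \<beta>\<^sub>0 * F (int r + e) + F (int r + e - 1)" by auto
qed

text \<open>The special quotient at r + n d already sits inside x (Suc (r + n * d)). The bound k < d
  stops just before the next special quotient, so only \<alpha> drives the recurrence in
  between.\<close>

lemma xi_block:
  fixes \<alpha> \<beta>\<^sub>0 \<beta>\<^sub>1 :: int and d r :: nat and x :: "nat \<Rightarrow> real"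
  defines "F \<equiv> \<lambda>n. poly (fib_poly n) (of_int \<alpha> :: real)"
  assumes rec: "\<And>k. x (Suc (Suc k)) = of_int (xi_quot \<alpha> \<beta>\<^sub>0 \<beta>\<^sub>1 d r (Suc k)) * x (Suc k) + x k"
  shows "k < d \<Longrightarrow> x (r + n * d + k) = F (int k) * x (Suc (r + n * d)) + F (int k - 1) * x (r + n * d)
    \<and> x (Suc (r + n * d + k)) = F (int k + 1) * x (Suc (r + n * d)) + F (int k) * x (r + n * d)"
proof (induction k)
  case 0
  show ?case by (simp add: F_def)
next
  case (Suc k)
  have "\<not> d dvd Suc k" using Suc.prems by (auto dest: dvd_imp_le)
  then have "\<not> d dvd (n * d + Suc k)" by (metis dvd_add_right_iff dvd_triv_right)
  then have "xi_quot \<alpha> \<beta>\<^sub>0 \<beta>\<^sub>1 d r (Suc (r + n * d + k)) = \<alpha>"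
    by (simp add: xi_quot_def add.assoc)
  then show ?case
    using Suc rec[of "r + n * d + k"] poly_fib_rec[of "int k + 2" "of_int \<alpha> :: real"]
      poly_fib_rec[of "int k + 1" "of_int \<alpha> :: real"]
    by (simp add: F_def algebra_simps)
qed

lemma xi_three_term:
  fixes \<alpha> \<beta>\<^sub>0 \<beta>\<^sub>1 :: int and d r :: nat and x :: "nat \<Rightarrow> real"
  defines "F \<equiv> \<lambda>n. poly (fib_poly n) (of_int \<alpha> :: real)"
  assumes "d > 0"
    and rec: "\<And>k. x (Suc (Suc k)) = of_int (xi_quot \<alpha> \<beta>\<^sub>0 \<beta>\<^sub>1 d r (Suc k)) * x (Suc k) + x k"
  shows "x (r + Suc n * d) = F (int d) * x (Suc (r + n * d)) + F (int d - 1) * x (r + n * d)"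
    and "x (r + Suc (Suc n) * d) =
      (F (int d) * of_int (\<beta>\<^sub>0 + \<beta>\<^sub>1 * int (Suc n)) + 2 * F (int d - 1)) * x (r + Suc n * d)
      + (- 1) ^ (d - 1) * x (r + n * d)"
proof -
  obtain k where d: "d = Suc k" using \<open>d > 0\<close> gr0_implies_Suc by blast
  have one: "x (r + Suc m * d) = F (int d) * x (Suc (r + m * d)) + F (int d - 1) * x (r + m * d)" for m
    using xi_block[OF rec, of k m] by (simp add: d F_def add_ac)
  then show "x (r + Suc n * d) = F (int d) * x (Suc (r + n * d)) + F (int d - 1) * x (r + n * d)" .
  define z where "z = x (Suc (r + n * d))"
  define X where "X = x (r + n * d)"
  have quot: "xi_quot \<alpha> \<beta>\<^sub>0 \<beta>\<^sub>1 d r (r + Suc n * d) = \<beta>\<^sub>0 + \<beta>\<^sub>1 * int (Suc n)"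
    using \<open>d > 0\<close> by (rule xi_quot_special)
  have idx: "Suc (r + n * d + k) = r + Suc n * d" by (simp add: d)
  have "x (Suc (r + Suc n * d)) =
      of_int (\<beta>\<^sub>0 + \<beta>\<^sub>1 * int (Suc n)) * x (r + Suc n * d) + x (r + n * d + k)"
    using rec[of "r + n * d + k"] unfolding idx quot .
  also have "x (r + n * d + k) = F (int d - 1) * z + F (int d - 2) * X"
    using xi_block[OF rec, of k n] by (simp add: d F_def z_def X_def algebra_simps)
  finally have z': "x (Suc (r + Suc n * d)) =
      of_int (\<beta>\<^sub>0 + \<beta>\<^sub>1 * int (Suc n)) * x (r + Suc n * d) + (F (int d - 1) * z + F (int d - 2) * X)" .
  have cassini: "F (int d) * F (int d - 2) - F (int d - 1) * F (int d - 1) = (- 1) ^ (d - 1)"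
    using fib_poly_dOcagne[of "int d" "of_int \<alpha> :: real" k] by (simp add: F_def d)
  \<comment> \<open>Multiplying by F_d makes F_d z available, which the one-block formula expresses
    without z; what remains in front of X is the Cassini determinant.\<close>
  have "F (int d) * (F (int d - 1) * z + F (int d - 2) * X)
      = F (int d - 1) * x (r + Suc n * d)
        + (F (int d) * F (int d - 2) - F (int d - 1) * F (int d - 1)) * X"
    unfolding one[of n, folded z_def X_def] by (simp add: algebra_simps)
  then show "x (r + Suc (Suc n) * d) =
      (F (int d) * of_int (\<beta>\<^sub>0 + \<beta>\<^sub>1 * int (Suc n)) + 2 * F (int d - 1)) * x (r + Suc n * d)
      + (- 1) ^ (d - 1) * x (r + n * d)"
    unfolding one[of "Suc n"] z' cassini X_def[symmetric]
    by (simp add: distrib_left distrib_right mult.assoc)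
qed

text \<open>The assumptions on c \<sigma> and \<open>c\<^sup>2 * \<rho>\<close> are the definitions
  of \<sigma> and \<rho> cleared of denominators. The leading coefficient of
  \<open>xi_three_term\<close> becomes c (\<sigma> + n + 1), so dividing by
  \<open>c ^ n * pochhammer \<sigma> n\<close> normalises it to 1.\<close>

lemma xi_recurrence_limit:
  fixes \<alpha> \<beta>\<^sub>0 \<beta>\<^sub>1 :: int and d r s :: nat and x :: "nat \<Rightarrow> real" and \<sigma> \<rho> :: real
  defines "F \<equiv> \<lambda>n. poly (fib_poly n) (of_int \<alpha> :: real)"
  defines "c \<equiv> F (int d) * of_int \<beta>\<^sub>1"
  assumes "d > 0" "c > 0" "\<sigma> > 0"
    and \<sigma>: "c * \<sigma> = F (int d) * of_int \<beta>\<^sub>0 + 2 * F (int d - 1)"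
    and \<rho>: "c\<^sup>2 * \<rho> = (- 1) ^ (d - 1)"
    and rec: "\<And>k. x (Suc (Suc k)) = of_int (xi_quot \<alpha> \<beta>\<^sub>0 \<beta>\<^sub>1 d r (Suc k)) * x (Suc k) + x k"
    and xr: "x r = F (int s)" "x (Suc r) = of_int \<beta>\<^sub>0 * F (int s) + F (int s - 1)"
  shows "(\<lambda>n. x (r + n * d) / (c ^ n * pochhammer \<sigma> n)) \<longlonglongrightarrow>
    F (int s) * hyp0F1 \<sigma> \<rho> + (- 1) ^ s * F (int d - int s) / (c * \<sigma>) * hyp0F1 (\<sigma> + 1) \<rho>"
proof -
  define u where "u = (\<lambda>n. x (r + n * d) / (c ^ n * pochhammer \<sigma> n))"
  have u_rec: "u (Suc (Suc n)) = u (Suc n) + \<rho> / ((\<sigma> + n) * (\<sigma> + n + 1)) * u n" for n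
  proof -
    define P where "P = pochhammer \<sigma> n"
    define X where "X = x (r + n * d)"
    define Y where "Y = x (r + Suc n * d)"
    have P: "P > 0" using \<open>\<sigma> > 0\<close> by (simp add: P_def pochhammer_pos)
    have "F (int d) * of_int (\<beta>\<^sub>0 + \<beta>\<^sub>1 * int (Suc n)) + 2 * F (int d - 1) = c * (\<sigma> + n + 1)"
      using \<sigma> by (simp add: algebra_simps c_def)
    then have "x (r + Suc (Suc n) * d) = c * (\<sigma> + n + 1) * Y + c\<^sup>2 * \<rho> * X"
      using xi_three_term(2)[OF \<open>d > 0\<close> rec, of n] unfolding F_def \<rho> X_def Y_def by simp
    then have "u (Suc (Suc n)) = (c * (\<sigma> + n + 1) * Y + c\<^sup>2 * \<rho> * X) /
        (c ^ n * c\<^sup>2 * (P * (\<sigma> + n) * (\<sigma> + n + 1)))"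
      by (simp add: u_def pochhammer_Suc P_def power2_eq_square mult_ac add_ac)
    moreover have "u (Suc n) = Y / (c ^ n * c * (P * (\<sigma> + n)))"
      by (simp add: u_def pochhammer_Suc P_def Y_def mult_ac)
    moreover have "u n = X / (c ^ n * P)"
      by (simp add: u_def P_def X_def)
    moreover have "(c * (S + 1) * Y + c\<^sup>2 * \<rho> * X) / (c ^ n * c\<^sup>2 * (P * S * (S + 1)))
        = Y / (c ^ n * c * (P * S)) + \<rho> / (S * (S + 1)) * (X / (c ^ n * P))" if "S > 0" for S
      using P \<open>c > 0\<close> that by (simp add: add_divide_distrib power2_eq_square mult_ac)
    ultimately show ?thesis
      using \<open>\<sigma> > 0\<close> by simp
  qed
  have u0: "u 0 = F (int s)" by (simp add: u_def xr)
  \<comment> \<open>c \<sigma> contains 2 F_{d-1} while x (r + d) supplies only one; the surplus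
    joins F_d F_{s-1} to form the d'Ocagne determinant.\<close>
  have "x (r + d) = c * \<sigma> * F (int s) + (F (int d) * F (int s - 1) - F (int d - 1) * F (int s))"
    using xi_three_term(1)[OF \<open>d > 0\<close> rec, of 0] xr
    unfolding \<sigma> by (simp add: F_def algebra_simps)
  also have "F (int d) * F (int s - 1) - F (int d - 1) * F (int s) = (- 1) ^ s * F (int d - int s)"
    unfolding F_def by (rule fib_poly_dOcagne)
  finally have "u 1 - u 0 = (- 1) ^ s * F (int d - int s) / (c * \<sigma>)"
    using \<open>c > 0\<close> \<open>\<sigma> > 0\<close> unfolding u0 by (simp add: u_def field_simps)
  then show ?thesis
    using three_term_limit[OF \<open>\<sigma> > 0\<close> u_rec] u0 by (simp add: u_def)
qed

section \<open>Specialisation to the numerators and denominators of the convergents\<close>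

theorem mainTheorem5:
  fixes \<alpha> \<beta>\<^sub>0 \<beta>\<^sub>1 :: int and d r :: nat
    and F :: "int \<Rightarrow> real" and L :: "nat \<Rightarrow> real"
    and p q :: "int \<Rightarrow> int" and \<sigma> \<rho> :: real
  assumes "\<alpha> > 0" and "\<beta>\<^sub>0 > 0" and "\<beta>\<^sub>1 > 0" and "d > 0"
  defines "F \<equiv> \<lambda>n. poly (fib_poly n) (of_int \<alpha>)"
    and "L \<equiv> \<lambda>n. poly (lucas_poly n) (of_int \<alpha>)"
    and "p \<equiv> conv_num (xi_quot \<alpha> \<beta>\<^sub>0 \<beta>\<^sub>1 d r)"
    and "q \<equiv> conv_denom (xi_quot \<alpha> \<beta>\<^sub>0 \<beta>\<^sub>1 d r)"
    and "\<sigma> \<equiv> (of_int \<beta>\<^sub>0 - of_int \<alpha>) / of_int \<beta>\<^sub>1 + L d / (of_int \<beta>\<^sub>1 * F (int d))"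
    and "\<rho> \<equiv> (- 1) ^ (d - 1) / ((of_int \<beta>\<^sub>1)\<^sup>2 * (F (int d))\<^sup>2)"
  shows "summable (\<lambda>m. \<rho> ^ m / (fact m * falling_fact (\<sigma> + real m - 1) m))
    \<and> summable (\<lambda>m. \<rho> ^ (m + 1) / (fact m * falling_fact (\<sigma> + real m) (m + 1)))
    \<and> ((\<lambda>n. of_int (p (int n * int d + int r - 1))
              / (F (int d) ^ n * of_int \<beta>\<^sub>1 ^ n * falling_fact (\<sigma> + real n - 1) n))
        \<longlonglongrightarrow> F (int r + 1) * (\<Sum>m. \<rho> ^ m / (fact m * falling_fact (\<sigma> + real m - 1) m))
          + (- 1) powi (int d - int r) * F (int d - int r - 1) * F (int d) * of_int \<beta>\<^sub>1
            * (\<Sum>m. \<rho> ^ (m + 1) / (fact m * falling_fact (\<sigma> + real m) (m + 1))))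
    \<and> ((\<lambda>n. of_int (q (int n * int d + int r - 1))
              / (F (int d) ^ n * of_int \<beta>\<^sub>1 ^ n * falling_fact (\<sigma> + real n - 1) n))
        \<longlonglongrightarrow> F (int r) * (\<Sum>m. \<rho> ^ m / (fact m * falling_fact (\<sigma> + real m - 1) m))
          + (- 1) powi (int d - int r + 1) * F (int d - int r) * F (int d) * of_int \<beta>\<^sub>1
            * (\<Sum>m. \<rho> ^ (m + 1) / (fact m * falling_fact (\<sigma> + real m) (m + 1))))"
proof -
  have F1: "F (int d) > 0" and F0: "F (int d - 1) \<ge> 0"
    using fib_poly_nonneg[of "of_int \<alpha>" "d - 1"] assms(1,4) by (simp_all add: F_def of_nat_diff)
  define c where "c = F (int d) * of_int \<beta>\<^sub>1"
  have c: "c > 0" using F1 assms(3) by (simp add: c_def)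
  have c\<sigma>: "c * \<sigma> = F (int d) * of_int \<beta>\<^sub>0 + 2 * F (int d - 1)"
    using F1 assms(3) lucas_poly_eq_fib_poly[of d "of_int \<alpha> :: real"]
    by (simp add: c_def \<sigma>_def L_def F_def field_simps)
  have "c * \<sigma> > 0"
    unfolding c\<sigma> using F1 F0 assms(2) by (intro add_pos_nonneg) auto
  then have \<sigma>: "\<sigma> > 0" using c by (simp add: zero_less_mult_iff)
  have c\<rho>: "c\<^sup>2 * \<rho> = (- 1) ^ (d - 1)"
    using F1 assms(3) by (simp add: c_def \<rho>_def power_mult_distrib)
  \<comment> \<open>Splitting off the factor \<sigma> in the second identity exhibits the second
    series as \<rho> / \<sigma> times \<open>hyp0F1\<close> at \<sigma> + 1.\<close>
  have ff: "falling_fact (\<sigma> + real m - 1) m = pochhammer \<sigma> m"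
    "falling_fact (\<sigma> + real m) (m + 1) = \<sigma> * pochhammer (\<sigma> + 1) m" for m
    using falling_fact_eq_pochhammer[of \<sigma> m] falling_fact_eq_pochhammer[of \<sigma> "Suc m"]
    by (simp_all add: pochhammer_rec)
  define A where "A = hyp0F1 \<sigma> \<rho>"
  define B where "B = hyp0F1 (\<sigma> + 1) \<rho>"
  have A: "summable (\<lambda>m. \<rho> ^ m / (fact m * pochhammer \<sigma> m))"
    "(\<Sum>m. \<rho> ^ m / (fact m * pochhammer \<sigma> m)) = A"
    using hyp0F1_summable[OF \<sigma>] by (simp_all add: A_def hyp0F1_def)
  have "(\<lambda>m. \<rho> ^ m / (fact m * pochhammer (\<sigma> + 1) m)) sums B"
    using hyp0F1_summable[of "\<sigma> + 1" \<rho>] \<sigma> by (simp add: B_def hyp0F1_def summable_sums)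
  from sums_mult[OF this, of "\<rho> / \<sigma>"]
  have "(\<lambda>m. \<rho> ^ (m + 1) / (fact m * (\<sigma> * pochhammer (\<sigma> + 1) m))) sums (\<rho> / \<sigma> * B)"
    by (simp add: mult_ac)
  then have B: "summable (\<lambda>m. \<rho> ^ (m + 1) / (fact m * (\<sigma> * pochhammer (\<sigma> + 1) m)))"
    "(\<Sum>m. \<rho> ^ (m + 1) / (fact m * (\<sigma> * pochhammer (\<sigma> + 1) m))) = \<rho> / \<sigma> * B"
    by (auto simp: sums_iff)
  \<comment> \<open>Since \<open>c\<^sup>2 * \<rho>\<close> is the sign (-1)^(d-1), the factor 1 / c
    equals c \<rho> up to that sign, and c is F_d times \<open>\<beta>\<^sub>1\<close>. The exponent
    d - s + 1 may be negative, hence \<open>powi\<close>.\<close>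
  have coeff: "(- 1) ^ s * F k / (c * \<sigma>) * B
      = (- 1) powi (int d - int s + 1) * F k * F (int d) * of_int \<beta>\<^sub>1 * (\<rho> / \<sigma> * B)" for s k
  proof -
    have "(- 1) powi (int d - int s + 1) * (- 1) ^ (d - 1) = (- 1 :: real) ^ s"
      using assms(4) by (simp add: power_int_minus_left uminus_power_if)
    moreover have "\<rho> = (- 1) ^ (d - 1) / c\<^sup>2" using c\<rho> c by (simp add: field_simps)
    ultimately have "(- 1) powi (int d - int s + 1) * \<rho> = (- 1) ^ s / c\<^sup>2" by simp
    then have "(- 1) powi (int d - int s + 1) * F k * F (int d) * of_int \<beta>\<^sub>1 * (\<rho> / \<sigma> * B)
        = (- 1) ^ s / c\<^sup>2 * F k * c / \<sigma> * B"
      by (simp add: c_def mult_ac flip: times_divide_eq_right)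
    then show ?thesis using c by (simp add: power2_eq_square)
  qed
  define a where "a = xi_quot \<alpha> \<beta>\<^sub>0 \<beta>\<^sub>1 d r"
  have lim: "(\<lambda>n. x (r + n * d) / (c ^ n * pochhammer \<sigma> n)) \<longlonglongrightarrow> F (int r + int e) * A
      + (- 1) powi (int d - int r + 1 - int e) * F (int d - int r - int e) * F (int d) * of_int \<beta>\<^sub>1
        * (\<rho> / \<sigma> * B)"
    if rec: "\<And>k. x (Suc (Suc k)) = of_int (a (Suc k)) * x (Suc k) + x k"
      and init: "x 0 = F (int e)" "x 1 = of_int (a 0) * F (int e) + F (int e - 1)" for x e
  proof -
    note seg = xi_initial_segment[OF rec[unfolded a_def] init[unfolded F_def a_def]]
    have "(\<lambda>n. x (r + n * d) / (c ^ n * pochhammer \<sigma> n)) \<longlonglongrightarrow> F (int (r + e)) * A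
        + (- 1) ^ (r + e) * F (int d - int (r + e)) / (c * \<sigma>) * B"
      unfolding A_def B_def c_def F_def
      by (rule xi_recurrence_limit[OF \<open>d > 0\<close> _ \<sigma> _ _ rec[unfolded a_def]])
        (use c c\<sigma> c\<rho> seg in \<open>simp_all add: c_def F_def\<close>)
    then show ?thesis
      unfolding coeff by (simp add: algebra_simps)
  qed
  have num: "(\<lambda>n. of_int (conv_num_shift a (r + n * d)) / (c ^ n * pochhammer \<sigma> n)) \<longlonglongrightarrow>
      F (int r + 1) * A
      + (- 1) powi (int d - int r) * F (int d - int r - 1) * F (int d) * of_int \<beta>\<^sub>1 * (\<rho> / \<sigma> * B)"
    using lim[of "\<lambda>k. of_int (conv_num_shift a k)" 1] by (simp add: F_def)
  have denom: "(\<lambda>n. of_int (conv_denom_shift a (r + n * d)) / (c ^ n * pochhammer \<sigma> n)) \<longlonglongrightarrow>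
      F (int r) * A
      + (- 1) powi (int d - int r + 1) * F (int d - int r) * F (int d) * of_int \<beta>\<^sub>1 * (\<rho> / \<sigma> * B)"
    using lim[of "\<lambda>k. of_int (conv_denom_shift a k)" 0] by (simp add: F_def)
  have idx: "nat (int n * int d + int r - 1 + 1) = r + n * d" for n
    by (simp add: nat_add_distrib nat_mult_distrib)
  show ?thesis
    unfolding ff p_def q_def conv_num_def conv_denom_def idx a_def[symmetric]
      power_mult_distrib[symmetric] c_def[symmetric] A(2) B(2)
    by (intro conjI A(1) B(1) num denom)
qed

end
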